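(* Let $P:\subseteq\mathbb{N}^{\mathbb{N}}\rightrightarrows\mathbb{N}^{\mathbb{N}}$ be a problem and let $P'$ be the problem with $\mathrm{dom}(P')=\mathrm{dom}(P)$ defined by $P'(p)=\mathrm{cl}(P(p))$. Then Player 2 has a winning strategy in the infinite-run discontinuity game for $P'$ if and only if $P$ does not have diagonalization opportunities for continuous functionals.
   Context: $\mathbb{N}^{\mathbb{N}}$ is Baire space; $\mathrm{cl}(X)$ is the closure of $X\subseteq\mathbb{N}^{\mathbb{N}}$; $\sigma\sqsubseteq x$ means the finite string $\sigma$ is an initial segment of $x$, and $[\![\sigma]\!]=\{x\in\mathbb{N}^{\mathbb{N}}:\sigma\sqsubseteq x\}$. A problem $P:\subseteq\mathbb{N}^{\mathbb{N}}\rightrightarrows\mathbb{N}^{\mathbb{N}}$ is a partial multivalued function: a set $\mathrm{dom}(P)$ of instances and, for each $p\in\mathrm{dom}(P)$, a set $P(p)\subseteq\mathbb{N}^{\mathbb{N}}$ of solutions; $P(p)=\emptyset$ is allowed. $P|[A\times B]$ has domain $\mathrm{dom}(P)\cap A$ and $P|[A\times B](x)=P(x)\cap B$. **Diagonalization opportunities.** A continuous functional $\Upsilon:\subseteq\mathbb{N}^{\mathbb{N}}\to\mathbb{N}^{\mathbb{N}}$ has a diagonalization opportunity for $P$ if there exist $p\in\mathrm{dom}(P)$ and finite strings $\sigma\sqsubseteq p$, $\rho\sqsubseteq\Upsilon(p)$ such that $\Upsilon([\![\sigma]\!])\subseteq[\![\rho]\!]$ (i.e. $\Upsilon(x)\in[\![\rho]\!]$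 for all $x\in\mathrm{dom}(\Upsilon)\cap[\![\sigma]\!]$) and $[\![\rho]\!]\cap P(p)=\emptyset$. $P$ has diagonalization opportunities for continuous functionals if every continuous functional which is total on $\mathrm{dom}(P)$ has a diagonalization opportunity for $P$. **Infinite-run discontinuity game for a problem $Q$.** Rounds are played as follows, starting with the current problem $Q$. In a round with current problem $R$: Player 1 plays $p\in\mathrm{dom}(R)$; if $R(p)=\emptyset$, Player 1 wins and the game ends; otherwise Player 2 plays $q\in R(p)$; Player 1 plays a finite $\rho\sqsubseteq q$; Player 2 plays a finite $\sigma\sqsubseteq p$; the next round is then played with current problem $R|[[\![\sigma]\!]\times[\![\rho]\!]]$. Player 2 wins a run if it is infinite. *)

theory Defs
  imports "HOL-Analysis.Function_Topology"
begin

text \<open>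
  Baire space carries the library's product topology on functions, over the discrete
  topology of \<^typ>\<open>nat\<close>; \<^const>\<open>closure\<close> and \<^const>\<open>continuous_on\<close> refer to it.
\<close>

type_synonym baire = "nat \<Rightarrow> nat"

definition initial_segment :: "nat list \<Rightarrow> baire \<Rightarrow> bool"  (infix "\<sqsubseteq>" 50)
  where "\<sigma> \<sqsubseteq> x \<longleftrightarrow> (\<forall>i < length \<sigma>. \<sigma> ! i = x i)"

definition cylinder :: "nat list \<Rightarrow> baire set"
  where "cylinder \<sigma> = {x. \<sigma> \<sqsubseteq> x}"

text \<open>
  In a problem, \<^term>\<open>None\<close> means that the argument is not an instance, whereas
  \<^term>\<open>Some {}\<close> means that it is an instance without solutions.
\<close>

type_synonym problem = "baire \<rightharpoonup> baire set"

definition solutions :: "problem \<Rightarrow> baire \<Rightarrow> baire set"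
  where "solutions P p = the (P p)"

definition restrict_problem :: "problem \<Rightarrow> baire set \<Rightarrow> baire set \<Rightarrow> problem"
  where "restrict_problem P A B = (\<lambda>x. if x \<in> A then map_option (\<lambda>S. S \<inter> B) (P x) else None)"

definition closure_problem :: "problem \<Rightarrow> problem"
  where "closure_problem P = (\<lambda>p. map_option closure (P p))"


subsection \<open>Diagonalization opportunities\<close>

type_synonym functional = "baire \<rightharpoonup> baire"

definition continuous_functional :: "functional \<Rightarrow> bool"
  where "continuous_functional \<Upsilon> \<longleftrightarrow> continuous_on (dom \<Upsilon>) (\<lambda>x. the (\<Upsilon> x))"

definition has_diagonalization_opportunity :: "functional \<Rightarrow> problem \<Rightarrow> bool"
  where "has_diagonalization_opportunity \<Upsilon> P \<longleftrightarrow>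
    (\<exists>p \<in> dom P. \<exists>y \<sigma> \<rho>. \<Upsilon> p = Some y \<and> \<sigma> \<sqsubseteq> p \<and> \<rho> \<sqsubseteq> y \<and>
      (\<forall>x \<in> dom \<Upsilon> \<inter> cylinder \<sigma>. the (\<Upsilon> x) \<in> cylinder \<rho>) \<and>
      cylinder \<rho> \<inter> solutions P p = {})"

definition diagonalization_opportunities_continuous :: "problem \<Rightarrow> bool"
  where "diagonalization_opportunities_continuous P \<longleftrightarrow>
    (\<forall>\<Upsilon>. continuous_functional \<Upsilon> \<and> dom P \<subseteq> dom \<Upsilon> \<longrightarrow> has_diagonalization_opportunity \<Upsilon> P)"


subsection \<open>The infinite-run discontinuity game\<close>

text \<open>
  A completed round \<open>(p, q, \<rho>, \<sigma>)\<close> lists the moves in the order in which they are made: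
  Player 1 plays \<open>p\<close> and \<open>\<rho>\<close>, Player 2 plays \<open>q\<close> and \<open>\<sigma>\<close>.
\<close>

type_synonym round = "baire \<times> baire \<times> nat list \<times> nat list"

fun legal_rounds :: "problem \<Rightarrow> round list \<Rightarrow> bool" where
  "legal_rounds R [] \<longleftrightarrow> True"
| "legal_rounds R ((p, q, \<rho>, \<sigma>) # h) \<longleftrightarrow>
    p \<in> dom R \<and> q \<in> solutions R p \<and> \<rho> \<sqsubseteq> q \<and> \<sigma> \<sqsubseteq> p \<and>
    legal_rounds (restrict_problem R (cylinder \<sigma>) (cylinder \<rho>)) h"

fun current_problem :: "problem \<Rightarrow> round list \<Rightarrow> problem" where
  "current_problem R [] = R"
| "current_problem R ((p, q, \<rho>, \<sigma>) # h) =
    current_problem (restrict_problem R (cylinder \<sigma>) (cylinder \<rho>)) h"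

text \<open>
  In \<open>Ended h p\<close>, after the completed rounds \<open>h\<close>, Player 1 plays an instance \<open>p\<close> of the current
  problem that has no solutions.
\<close>

datatype run = Ended "round list" baire | Infinite "nat \<Rightarrow> round"

fun is_run :: "problem \<Rightarrow> run \<Rightarrow> bool" where
  "is_run Q (Ended h p) \<longleftrightarrow> legal_rounds Q h \<and>
    p \<in> dom (current_problem Q h) \<and> solutions (current_problem Q h) p = {}"
| "is_run Q (Infinite r) \<longleftrightarrow> (\<forall>n. legal_rounds Q (map r [0..<n]))"

fun player2_wins :: "run \<Rightarrow> bool" where
  "player2_wins (Ended h p) \<longleftrightarrow> False"
| "player2_wins (Infinite r) \<longleftrightarrow> True"

text \<open>
  A strategy for Player 2 consists of a map choosing \<open>q\<close> and a map choosing \<open>\<sigma>\<close>, each taking the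
  completed rounds and the moves already made in the current round. It must respond by a legal
  move in every position reachable by legal moves in which it is Player 2's turn.
\<close>

type_synonym solution_choice = "round list \<Rightarrow> baire \<Rightarrow> baire"
type_synonym prefix_choice = "round list \<Rightarrow> baire \<Rightarrow> baire \<Rightarrow> nat list \<Rightarrow> nat list"

definition player2_strategy :: "problem \<Rightarrow> solution_choice \<Rightarrow> prefix_choice \<Rightarrow> bool"
  where "player2_strategy Q s t \<longleftrightarrow>
    (\<forall>h. legal_rounds Q h \<longrightarrow>
      (\<forall>p \<in> dom (current_problem Q h). solutions (current_problem Q h) p \<noteq> {} \<longrightarrow>
        s h p \<in> solutions (current_problem Q h) p \<and>
        (\<forall>q \<in> solutions (current_problem Q h) p. \<forall>\<rho>. \<rho> \<sqsubseteq> q \<longrightarrow> t h p q \<rho> \<sqsubseteq> p)))"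

definition rounds_follow :: "solution_choice \<Rightarrow> prefix_choice \<Rightarrow> round list \<Rightarrow> bool"
  where "rounds_follow s t h \<longleftrightarrow>
    (\<forall>i < length h. case h ! i of (p, q, \<rho>, \<sigma>) \<Rightarrow>
      q = s (take i h) p \<and> \<sigma> = t (take i h) p q \<rho>)"

fun run_follows :: "solution_choice \<Rightarrow> prefix_choice \<Rightarrow> run \<Rightarrow> bool" where
  "run_follows s t (Ended h p) \<longleftrightarrow> rounds_follow s t h"
| "run_follows s t (Infinite r) \<longleftrightarrow> (\<forall>n. rounds_follow s t (map r [0..<n]))"

text \<open>
  Every position of the game can be continued to a run, except that Player 1 cannot make his very
  first move if \<^term>\<open>dom Q = {}\<close>. In that case there are no runs, and every strategy of
  Player 2 is winning: a player who cannot move does not win.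
\<close>

definition player2_has_winning_strategy :: "problem \<Rightarrow> bool"
  where "player2_has_winning_strategy Q \<longleftrightarrow>
    (\<exists>s t. player2_strategy Q s t \<and>
      (\<forall>r. is_run Q r \<and> run_follows s t r \<longrightarrow> player2_wins r))"

end

theory Submission imports Defs begin

text \<open>
  Both sides say that \<open>P'\<close> has a continuous selection, that is, that some continuous function \<open>f\<close>
  on \<^term>\<open>dom P\<close> satisfies \<open>f p \<in> closure (P p)\<close> for all instances \<open>p\<close>.

  For diagonalization opportunities this is almost a matter of definition
  (\<open>no_opportunity_iff_selection\<close>): by continuity every prefix \<open>\<rho>\<close> of \<open>\<Upsilon> p\<close> is already forced by
  some prefix \<open>\<sigma>\<close> of \<open>p\<close>, so \<open>\<Upsilon>\<close> has no opportunity iff no prefix of \<open>\<Upsilon> p\<close> separates it from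
  \<open>P p\<close>, iff \<open>\<Upsilon> p\<close> lies in the closure of \<open>P p\<close>.

  For the game (\<open>wins_iff_selection\<close>), given a selection \<open>f\<close>, Player 2 answers \<open>p\<close> by \<open>f p\<close> and \<open>\<rho>\<close>
  by a \<open>\<sigma>\<close> forcing \<open>f\<close> into the cylinder of \<open>\<rho>\<close>. Then \<open>f\<close> remains a selection of every current
  problem, so that Player 1 never finds an instance without solutions. Conversely, let a winning
  strategy be given. To compute a solution for \<open>x\<close>, simulate runs in which the \<open>\<rho>\<close> of round \<open>n\<close>
  has length \<open>n + 1\<close>. Player 1 could always play \<open>x\<close> itself, but the strategy depends on all of
  \<open>x\<close> while the selection must be continuous. So among the prefixes of \<open>x\<close> that Player 2 would play
  as \<open>\<sigma>\<close> in response to some instance, take the shortest one, and let Player 1 play an instance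
  chosen for that prefix alone. Each position so reached depends on a finite part of \<open>x\<close> only, and
  \<open>x\<close> is still an instance of the current problem. As the strategy wins, \<open>x\<close> has a solution that
  extends all the strings \<open>\<rho>\<close> played so far. Hence the strings \<open>\<rho>\<close> form a chain, whose limit is a
  limit of solutions of \<open>x\<close> and thus a solution of \<open>P'\<close>, whose solution sets are closed.
\<close>

section \<open>Cylinders as a basis of Baire space\<close>

lemma initial_segment_map_iff: "map x [0..<k] \<sqsubseteq> y \<longleftrightarrow> (\<forall>i<k. y i = x i)"
  by (auto simp: initial_segment_def)

lemma initial_segment_iff_map: "\<sigma> \<sqsubseteq> x \<longleftrightarrow> \<sigma> = map x [0..<length \<sigma>]"
  unfolding initial_segment_def list_eq_iff_nth_eq by simp

lemma mem_cylinder [simp]: "x \<in> cylinder \<sigma> \<longleftrightarrow> \<sigma> \<sqsubseteq> x"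
  by (simp add: cylinder_def)

lemma open_cylinder: "open (cylinder \<sigma>)"
proof -
  have "cylinder \<sigma> = (\<Inter>i<length \<sigma>. (\<lambda>x. x i) -` {\<sigma> ! i})"
    by (auto simp: initial_segment_def)
  moreover have "open ((\<lambda>x::baire. x i) -` {\<sigma> ! i})" for i
    by (rule open_vimage) (auto simp: open_discrete)
  ultimately show ?thesis
    by auto
qed

lemma open_contains_cylinder:
  assumes "open U" "x \<in> U"
  shows "\<exists>n. cylinder (map x [0..<n]) \<subseteq> U"
proof -
  have "openin (product_topology (\<lambda>i::nat. euclidean :: nat topology) UNIV) U"
    using assms(1) by (simp add: open_fun_def)
  then obtain X where X: "x \<in> Pi\<^sub>E UNIV X" "finite {i. X i \<noteq> topspace (euclidean :: nat topology)}"
      "Pi\<^sub>E UNIV X \<subseteq> U"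
    using product_topology_open_contains_basis[OF _ assms(2)] by blast
  then obtain n where n: "\<And>i. X i \<noteq> UNIV \<Longrightarrow> i < n"
    by (auto simp: finite_nat_set_iff_bounded)
  have "y \<in> Pi\<^sub>E UNIV X" if "\<forall>i<n. y i = x i" for y
    using X(1) n that by (fastforce simp: PiE_iff)
  with X(3) show ?thesis
    by (intro exI[of _ n]) (auto simp: initial_segment_map_iff subset_iff simp del: PiE_UNIV_domain)
qed

lemma mem_closure_iff_cylinder:
  "y \<in> closure S \<longleftrightarrow> (\<forall>\<rho>. \<rho> \<sqsubseteq> y \<longrightarrow> cylinder \<rho> \<inter> S \<noteq> {})"
proof
  assume "y \<in> closure S"
  then show "\<forall>\<rho>. \<rho> \<sqsubseteq> y \<longrightarrow> cylinder \<rho> \<inter> S \<noteq> {}"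
    using open_cylinder by (metis mem_cylinder closure_iff_nhds_not_empty inf_commute order_refl)
next
  assume *: "\<forall>\<rho>. \<rho> \<sqsubseteq> y \<longrightarrow> cylinder \<rho> \<inter> S \<noteq> {}"
  show "y \<in> closure S"
    unfolding closure_iff_nhds_not_empty
  proof (intro allI impI)
    fix A U assume "U \<subseteq> A" "open U" "y \<in> U"
    with open_contains_cylinder obtain n where "cylinder (map y [0..<n]) \<subseteq> U"
      by blast
    moreover have "cylinder (map y [0..<n]) \<inter> S \<noteq> {}"
      using * by (simp add: initial_segment_map_iff)
    ultimately show "S \<inter> A \<noteq> {}"
      using \<open>U \<subseteq> A\<close> by blast
  qed
qed

lemma continuous_on_iff_cylinder:
  "continuous_on A (f :: baire \<Rightarrow> baire) \<longleftrightarrow>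
    (\<forall>x\<in>A. \<forall>\<rho>. \<rho> \<sqsubseteq> f x \<longrightarrow> (\<exists>\<sigma>. \<sigma> \<sqsubseteq> x \<and> (\<forall>y\<in>A. \<sigma> \<sqsubseteq> y \<longrightarrow> \<rho> \<sqsubseteq> f y)))"
proof
  assume f: "continuous_on A f"
  show "\<forall>x\<in>A. \<forall>\<rho>. \<rho> \<sqsubseteq> f x \<longrightarrow> (\<exists>\<sigma>. \<sigma> \<sqsubseteq> x \<and> (\<forall>y\<in>A. \<sigma> \<sqsubseteq> y \<longrightarrow> \<rho> \<sqsubseteq> f y))"
  proof (intro ballI allI impI)
    fix x \<rho> assume "x \<in> A" "\<rho> \<sqsubseteq> f x"
    then obtain U where U: "open U" "x \<in> U" "\<forall>y\<in>A. y \<in> U \<longrightarrow> f y \<in> cylinder \<rho>"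
      using f open_cylinder unfolding continuous_on_topological by (metis mem_cylinder)
    then obtain n where "cylinder (map x [0..<n]) \<subseteq> U"
      using open_contains_cylinder by blast
    with U(3) show "\<exists>\<sigma>. \<sigma> \<sqsubseteq> x \<and> (\<forall>y\<in>A. \<sigma> \<sqsubseteq> y \<longrightarrow> \<rho> \<sqsubseteq> f y)"
      by (intro exI[of _ "map x [0..<n]"]) (auto simp: initial_segment_map_iff subset_iff)
  qed
next
  assume *: "\<forall>x\<in>A. \<forall>\<rho>. \<rho> \<sqsubseteq> f x \<longrightarrow> (\<exists>\<sigma>. \<sigma> \<sqsubseteq> x \<and> (\<forall>y\<in>A. \<sigma> \<sqsubseteq> y \<longrightarrow> \<rho> \<sqsubseteq> f y))"
  show "continuous_on A f"
    unfolding continuous_on_topological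
  proof (intro ballI allI impI)
    fix x U assume x: "x \<in> A" and "open U" "f x \<in> U"
    then obtain n where n: "cylinder (map (f x) [0..<n]) \<subseteq> U"
      using open_contains_cylinder by blast
    moreover have "map (f x) [0..<n] \<sqsubseteq> f x"
      by (simp add: initial_segment_map_iff)
    then obtain \<sigma> where "\<sigma> \<sqsubseteq> x" "\<forall>y\<in>A. \<sigma> \<sqsubseteq> y \<longrightarrow> map (f x) [0..<n] \<sqsubseteq> f y"
      using * x by blast
    ultimately show "\<exists>V. open V \<and> x \<in> V \<and> (\<forall>y\<in>A. y \<in> V \<longrightarrow> f y \<in> U)"
      using open_cylinder by (intro exI[of _ "cylinder \<sigma>"]) auto
  qed
qed


section \<open>Diagonalization opportunities and continuous selections\<close>

definition continuous_selection :: "problem \<Rightarrow> (baire \<Rightarrow> baire) \<Rightarrow> bool"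
  where "continuous_selection Q f \<longleftrightarrow>
    continuous_on (dom Q) f \<and> (\<forall>p\<in>dom Q. f p \<in> solutions Q p)"

lemma dom_closure_problem [simp]: "dom (closure_problem P) = dom P"
  by (auto simp: closure_problem_def)

lemma solutions_closure_problem:
  "p \<in> dom P \<Longrightarrow> solutions (closure_problem P) p = closure (solutions P p)"
  by (auto simp: closure_problem_def solutions_def)

lemma no_opportunity_iff_selection:
  "\<not> diagonalization_opportunities_continuous P \<longleftrightarrow>
    (\<exists>f. continuous_selection (closure_problem P) f)"
proof
  assume "\<not> diagonalization_opportunities_continuous P"
  then obtain \<Upsilon> where \<Upsilon>: "continuous_functional \<Upsilon>" "dom P \<subseteq> dom \<Upsilon>"
      "\<not> has_diagonalization_opportunity \<Upsilon> P"
    by (auto simp: diagonalization_opportunities_continuous_def)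
  let ?f = "\<lambda>x. the (\<Upsilon> x)"
  have cont: "continuous_on (dom \<Upsilon>) ?f"
    using \<Upsilon>(1) by (simp add: continuous_functional_def)
  have "?f p \<in> closure (solutions P p)" if p: "p \<in> dom P" for p
    unfolding mem_closure_iff_cylinder
  proof (intro allI impI)
    fix \<rho> assume \<rho>: "\<rho> \<sqsubseteq> ?f p"
    have "p \<in> dom \<Upsilon>"
      using p \<Upsilon>(2) by blast
    then obtain \<sigma> where "\<sigma> \<sqsubseteq> p" "\<forall>y\<in>dom \<Upsilon>. \<sigma> \<sqsubseteq> y \<longrightarrow> \<rho> \<sqsubseteq> ?f y"
      using cont \<rho> unfolding continuous_on_iff_cylinder by meson
    moreover have "\<Upsilon> p = Some (?f p)"
      using \<open>p \<in> dom \<Upsilon>\<close> by auto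
    ultimately show "cylinder \<rho> \<inter> solutions P p \<noteq> {}"
      using \<Upsilon>(3) p \<rho> unfolding has_diagonalization_opportunity_def
      by (metis Int_iff mem_cylinder)
  qed
  then have "continuous_selection (closure_problem P) ?f"
    using continuous_on_subset[OF cont \<Upsilon>(2)]
    by (simp add: continuous_selection_def solutions_closure_problem)
  then show "\<exists>f. continuous_selection (closure_problem P) f"
    by blast
next
  assume "\<exists>f. continuous_selection (closure_problem P) f"
  then obtain f where f: "continuous_on (dom P) f" "\<forall>p\<in>dom P. f p \<in> closure (solutions P p)"
    by (auto simp: continuous_selection_def solutions_closure_problem)
  define \<Upsilon> where "\<Upsilon> = (\<lambda>x. if x \<in> dom P then Some (f x) else None)"
  have dom: "dom \<Upsilon> = dom P"
    by (auto simp: \<Upsilon>_def split: if_splits)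
  have "continuous_on (dom P) (\<lambda>x. the (\<Upsilon> x))"
    using f(1) by (rule continuous_on_eq) (simp add: \<Upsilon>_def)
  then have "continuous_functional \<Upsilon>"
    by (simp add: continuous_functional_def dom)
  moreover have "\<not> has_diagonalization_opportunity \<Upsilon> P"
    using f(2) by (auto simp: has_diagonalization_opportunity_def mem_closure_iff_cylinder \<Upsilon>_def)
  ultimately show "\<not> diagonalization_opportunities_continuous P"
    using dom by (auto simp: diagonalization_opportunities_continuous_def)
qed


section \<open>Positions of the game\<close>

lemma mem_dom_restrict_problem [simp]:
  "x \<in> dom (restrict_problem R A B) \<longleftrightarrow> x \<in> dom R \<and> x \<in> A"
  by (auto simp: restrict_problem_def split: if_splits)

lemma solutions_restrict_problem [simp]:
  "x \<in> dom R \<Longrightarrow> x \<in> A \<Longrightarrow> solutions (restrict_problem R A B) x = solutions R x \<inter> B"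
  by (auto simp: restrict_problem_def solutions_def)

lemma current_problem_snoc:
  "current_problem R (h @ [(p, q, \<rho>, \<sigma>)]) =
    restrict_problem (current_problem R h) (cylinder \<sigma>) (cylinder \<rho>)"
  by (induction R h rule: current_problem.induct) auto

lemma legal_rounds_snoc:
  "legal_rounds R (h @ [(p, q, \<rho>, \<sigma>)]) \<longleftrightarrow> legal_rounds R h \<and>
    p \<in> dom (current_problem R h) \<and> q \<in> solutions (current_problem R h) p \<and> \<rho> \<sqsubseteq> q \<and> \<sigma> \<sqsubseteq> p"
  by (induction R h rule: current_problem.induct) auto

lemma rounds_follow_snoc:
  "rounds_follow s t (h @ [(p, q, \<rho>, \<sigma>)]) \<longleftrightarrow>
    rounds_follow s t h \<and> q = s h p \<and> \<sigma> = t h p q \<rho>"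
  unfolding rounds_follow_def length_append_singleton All_less_Suc by (auto simp: nth_append)

lemma dom_current_problem: "x \<in> dom (current_problem R h) \<Longrightarrow> x \<in> dom R"
  by (induction R h rule: current_problem.induct) auto

lemma mem_solutions_current_problem:
  assumes "x \<in> dom (current_problem R h)" "z \<in> solutions (current_problem R h) x"
  shows "z \<in> solutions R x \<and> (\<forall>(p, q, \<rho>, \<sigma>) \<in> set h. \<rho> \<sqsubseteq> z)"
  using assms
proof (induction R h rule: current_problem.induct)
  case (2 R p q \<rho> \<sigma> h)
  then show ?case
    using dom_current_problem[of x "restrict_problem R (cylinder \<sigma>) (cylinder \<rho>)" h] by auto
qed simp

text \<open>
  Infinite runs are won by Player 2, so a strategy can only fail in a position where Player 1 has
  an instance without solutions.
\<close>

lemma player2_has_winning_strategy_iff: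
  "player2_has_winning_strategy Q \<longleftrightarrow>
    (\<exists>s t. player2_strategy Q s t \<and>
      (\<forall>h. legal_rounds Q h \<and> rounds_follow s t h \<longrightarrow>
        (\<forall>p \<in> dom (current_problem Q h). solutions (current_problem Q h) p \<noteq> {})))"
proof -
  have "(\<forall>r. is_run Q r \<and> run_follows s t r \<longrightarrow> player2_wins r) \<longleftrightarrow>
      (\<forall>h. legal_rounds Q h \<and> rounds_follow s t h \<longrightarrow>
        (\<forall>p \<in> dom (current_problem Q h). solutions (current_problem Q h) p \<noteq> {}))"
    (is "?L \<longleftrightarrow> ?R") for s t
  proof
    assume L: ?L
    show ?R
      using L[rule_format, of "Ended _ _"] by auto
  next
    assume R: ?R
    show ?L
    proof (intro allI impI)
      fix r assume r: "is_run Q r \<and> run_follows s t r"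
      show "player2_wins r"
        using r R by (cases r) auto
    qed
  qed
  then show ?thesis
    by (simp add: player2_has_winning_strategy_def)
qed


section \<open>From a continuous selection to a winning strategy\<close>

text \<open>
  Off the runs in which Player 2 has always played the selection, that selection may no longer
  solve the current problem; there the strategy falls back on arbitrary legal moves.
\<close>

lemma selection_imp_wins:
  assumes "continuous_selection Q f"
  shows "player2_has_winning_strategy Q"
proof -
  have cont: "continuous_on (dom Q) f" and sel: "\<forall>p\<in>dom Q. f p \<in> solutions Q p"
    using assms by (auto simp: continuous_selection_def)
  define s :: solution_choice where
    "s = (\<lambda>h p. if f p \<in> solutions (current_problem Q h) p then f p
      else (SOME q. q \<in> solutions (current_problem Q h) p))"
  define forces where "forces = (\<lambda>p \<rho> \<sigma>. \<sigma> \<sqsubseteq> p \<and> (\<forall>x\<in>dom Q. \<sigma> \<sqsubseteq> x \<longrightarrow> \<rho> \<sqsubseteq> f x))"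
  define t :: prefix_choice where
    "t = (\<lambda>h p q \<rho>. if \<exists>\<sigma>. forces p \<rho> \<sigma> then SOME \<sigma>. forces p \<rho> \<sigma> else [])"
  have forces: "forces p \<rho> (t h p q \<rho>)" if "p \<in> dom Q" "\<rho> \<sqsubseteq> f p" for h p q \<rho>
  proof -
    have "\<exists>\<sigma>. forces p \<rho> \<sigma>"
      using cont that unfolding continuous_on_iff_cylinder forces_def by blast
    then show ?thesis
      by (simp add: t_def someI_ex)
  qed
  have t: "t h p q \<rho> \<sqsubseteq> p" for h p q \<rho>
  proof (cases "\<exists>\<sigma>. forces p \<rho> \<sigma>")
    case True
    then have "forces p \<rho> (t h p q \<rho>)"
      by (simp add: t_def someI_ex)
    then show ?thesis
      by (simp add: forces_def)
  next
    case False
    then have "t h p q \<rho> = []"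
      unfolding t_def by (rule if_not_P)
    then show ?thesis
      by (simp add: initial_segment_def)
  qed
  have "s h p \<in> solutions (current_problem Q h) p"
    if "solutions (current_problem Q h) p \<noteq> {}" for h p
    using that by (simp add: s_def some_in_eq)
  with t have strategy: "player2_strategy Q s t"
    by (simp add: player2_strategy_def)
  have invariant: "f x \<in> solutions (current_problem Q h) x"
    if "legal_rounds Q h" "rounds_follow s t h" "x \<in> dom (current_problem Q h)" for h x
    using that
  proof (induction h arbitrary: x rule: rev_induct)
    case Nil
    then show ?case
      using sel by simp
  next
    case (snoc r h)
    obtain p q \<rho> \<sigma> where r: "r = (p, q, \<rho>, \<sigma>)"
      by (cases r)
    have legal: "legal_rounds Q h" "p \<in> dom (current_problem Q h)" "\<rho> \<sqsubseteq> q"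
      and follow: "rounds_follow s t h" "q = s h p" "\<sigma> = t h p q \<rho>"
      and x: "x \<in> dom (current_problem Q h)" "\<sigma> \<sqsubseteq> x"
      using snoc.prems
      by (auto simp: r legal_rounds_snoc rounds_follow_snoc current_problem_snoc)
    have "q = f p"
      using snoc.IH[OF legal(1) follow(1) legal(2)] follow(2) by (simp add: s_def)
    then have "forces p \<rho> \<sigma>"
      using forces legal dom_current_problem follow(3) by blast
    then have "\<rho> \<sqsubseteq> f x"
      using x dom_current_problem unfolding forces_def by blast
    then show ?case
      using snoc.IH[OF legal(1) follow(1) x(1)] x by (simp add: r current_problem_snoc)
  qed
  show ?thesis
    unfolding player2_has_winning_strategy_iff using strategy invariant by blast
qed


section \<open>From a winning strategy to a continuous selection\<close>

locale winning_strategy =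
  fixes Q :: problem and s :: solution_choice and t :: prefix_choice
  assumes strategy: "player2_strategy Q s t"
    and solvable: "\<And>h p. legal_rounds Q h \<Longrightarrow> rounds_follow s t h \<Longrightarrow>
      p \<in> dom (current_problem Q h) \<Longrightarrow> solutions (current_problem Q h) p \<noteq> {}"
begin

definition revealed :: "round list \<Rightarrow> baire \<Rightarrow> nat list"
  where "revealed h p = map (s h p) [0..<Suc (length h)]"

definition reply :: "round list \<Rightarrow> baire \<Rightarrow> nat list"
  where "reply h p = t h p (s h p) (revealed h p)"

definition reply_length :: "round list \<Rightarrow> baire \<Rightarrow> nat"
  where "reply_length h x = (LEAST k. \<exists>p \<in> dom (current_problem Q h). reply h p = map x [0..<k])"

text \<open>
  The instance that Player 1 plays on behalf of \<open>x\<close>: the defining property mentions \<open>x\<close> only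
  through the shortest prefix of \<open>x\<close> that occurs as a reply, so that all points of the cylinder of
  that prefix share one instance.
\<close>

definition representative :: "round list \<Rightarrow> baire \<Rightarrow> baire"
  where "representative h x = (SOME p. p \<in> dom (current_problem Q h) \<and>
    reply h p = map x [0..<reply_length h x])"

fun position :: "baire \<Rightarrow> nat \<Rightarrow> round list" where
  "position x 0 = []"
| "position x (Suc n) = (let h = position x n; p = representative h x
    in h @ [(p, s h p, revealed h p, reply h p)])"

definition selection :: "baire \<Rightarrow> baire"
  where "selection x i = (case position x (Suc i) ! i of (p, q, \<rho>, \<sigma>) \<Rightarrow> q i)"

lemma length_position [simp]: "length (position x n) = n"
  by (induction n) (auto simp: Let_def)

lemma nth_position: "i < n \<Longrightarrow> position x n ! i = position x (Suc i) ! i"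
  by (induction n) (auto simp: Let_def nth_append less_Suc_eq)

lemma legal_replies:
  assumes "legal_rounds Q h" "rounds_follow s t h" "p \<in> dom (current_problem Q h)"
  shows "s h p \<in> solutions (current_problem Q h) p" "revealed h p \<sqsubseteq> s h p" "reply h p \<sqsubseteq> p"
proof -
  show q: "s h p \<in> solutions (current_problem Q h) p"
    using strategy solvable[OF assms] assms by (auto simp: player2_strategy_def)
  show \<rho>: "revealed h p \<sqsubseteq> s h p"
    unfolding revealed_def initial_segment_map_iff by simp
  show "reply h p \<sqsubseteq> p"
    using strategy solvable[OF assms] assms q \<rho> unfolding player2_strategy_def reply_def by blast
qed

text \<open>
  Some prefix of \<open>x\<close> is a reply, namely the one given when \<open>x\<close> itself is played. This makes the
  shortest such prefix and the representative meaningful.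
\<close>

lemma representative_correct:
  assumes "legal_rounds Q h" "rounds_follow s t h" "x \<in> dom (current_problem Q h)"
  shows "representative h x \<in> dom (current_problem Q h)"
    and "reply h (representative h x) = map x [0..<reply_length h x]"
proof -
  have "reply h x = map x [0..<length (reply h x)]"
    using legal_replies(3)[OF assms] unfolding initial_segment_iff_map .
  with assms(3) have "\<exists>k. \<exists>p \<in> dom (current_problem Q h). reply h p = map x [0..<k]"
    by blast
  then have "\<exists>p \<in> dom (current_problem Q h). reply h p = map x [0..<reply_length h x]"
    unfolding reply_length_def by (rule LeastI_ex)
  then have "\<exists>p. p \<in> dom (current_problem Q h) \<and> reply h p = map x [0..<reply_length h x]"
    by blast
  then have "representative h x \<in> dom (current_problem Q h) \<and>
      reply h (representative h x) = map x [0..<reply_length h x]"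
    unfolding representative_def by (rule someI_ex)
  then show "representative h x \<in> dom (current_problem Q h)"
    and "reply h (representative h x) = map x [0..<reply_length h x]"
    by blast+
qed

lemma position_correct:
  assumes "x \<in> dom Q"
  shows "legal_rounds Q (position x n) \<and> rounds_follow s t (position x n) \<and>
    x \<in> dom (current_problem Q (position x n))"
proof (induction n)
  case 0
  then show ?case
    using assms by (simp add: rounds_follow_def)
next
  case (Suc n)
  define h where "h = position x n"
  define p where "p = representative h x"
  have h: "legal_rounds Q h" "rounds_follow s t h" "x \<in> dom (current_problem Q h)"
    using Suc by (auto simp: h_def)
  have p: "p \<in> dom (current_problem Q h)" and "reply h p \<sqsubseteq> x"
    using representative_correct[OF h] by (auto simp: p_def initial_segment_map_iff)
  moreover have "position x (Suc n) = h @ [(p, s h p, revealed h p, reply h p)]"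
    by (simp add: h_def p_def Let_def)
  ultimately show ?case
    using h legal_replies[OF h(1,2) p]
    by (simp only: legal_rounds_snoc rounds_follow_snoc current_problem_snoc
        mem_dom_restrict_problem mem_cylinder reply_def simp_thms)
qed

text \<open>
  Two points that agree on the shortest reply below one of them also have the same shortest reply,
  since shorter candidates are prefixes of both points.
\<close>

lemma representative_cong:
  assumes "legal_rounds Q h" "rounds_follow s t h" "x \<in> dom (current_problem Q h)"
    and agree: "\<forall>i<reply_length h x. y i = x i"
  shows "representative h y = representative h x"
proof -
  have eq: "map y [0..<k] = map x [0..<k]" if "k \<le> reply_length h x" for k
    using agree that by auto
  have "reply_length h y = reply_length h x"
    unfolding reply_length_def[of h y]
  proof (rule Least_equality)
    show "\<exists>p \<in> dom (current_problem Q h). reply h p = map y [0..<reply_length h x]"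
      using representative_correct[OF assms(1-3)] unfolding eq[OF order_refl] by blast
  next
    fix k assume k: "\<exists>p \<in> dom (current_problem Q h). reply h p = map y [0..<k]"
    show "reply_length h x \<le> k"
    proof (rule ccontr)
      assume less: "\<not> reply_length h x \<le> k"
      with k eq[of k] have "\<exists>p \<in> dom (current_problem Q h). reply h p = map x [0..<k]"
        by simp
      then have "reply_length h x \<le> k"
        unfolding reply_length_def by (rule Least_le)
      with less show False ..
    qed
  qed
  then show ?thesis
    unfolding representative_def by (simp only: eq[OF order_refl])
qed

lemma position_locally_constant:
  assumes "x \<in> dom Q"
  shows "\<exists>k. \<forall>y. (\<forall>i<k. y i = x i) \<longrightarrow> position y n = position x n"
proof (induction n)
  case 0
  then show ?case
    by simp
next
  case (Suc n)
  then obtain k where k: "\<And>y. \<forall>i<k. y i = x i \<Longrightarrow> position y n = position x n"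
    by blast
  let ?k = "max k (reply_length (position x n) x)"
  have "position y (Suc n) = position x (Suc n)" if "\<forall>i<?k. y i = x i" for y
  proof -
    have "representative (position x n) y = representative (position x n) x"
      using position_correct[OF assms, of n] that by (intro representative_cong) auto
    moreover have "position y n = position x n"
      using that by (intro k) auto
    ultimately show ?thesis
      by (simp add: Let_def)
  qed
  then show ?case
    by blast
qed

lemma continuous_on_selection: "continuous_on (dom Q) selection"
  unfolding continuous_on_iff_cylinder
proof (intro ballI allI impI)
  fix x \<rho> assume x: "x \<in> dom Q" and \<rho>: "\<rho> \<sqsubseteq> selection x"
  obtain k where k: "\<And>y. \<forall>i<k. y i = x i \<Longrightarrow> position y (length \<rho>) = position x (length \<rho>)"
    using position_locally_constant[OF x] by blast
  have "\<rho> \<sqsubseteq> selection y" if "map x [0..<k] \<sqsubseteq> y" for y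
  proof -
    have "position y (length \<rho>) = position x (length \<rho>)"
      using that by (intro k) (simp add: initial_segment_map_iff)
    then have "selection y i = selection x i" if "i < length \<rho>" for i
      using that nth_position[of i "length \<rho>"] unfolding selection_def by metis
    then show ?thesis
      using \<rho> by (simp add: initial_segment_def)
  qed
  then show "\<exists>\<sigma>. \<sigma> \<sqsubseteq> x \<and> (\<forall>y\<in>dom Q. \<sigma> \<sqsubseteq> y \<longrightarrow> \<rho> \<sqsubseteq> selection y)"
    by (intro exI[of _ "map x [0..<k]"]) (simp add: initial_segment_map_iff)
qed

text \<open>
  Since the strategy wins, \<open>x\<close> still has a solution after \<open>n\<close> rounds; that solution extends all
  strings revealed so far and therefore agrees with the selection on the first \<open>n\<close> digits.
\<close>

lemma selection_in_closure:
  assumes "x \<in> dom Q"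
  shows "selection x \<in> closure (solutions Q x)"
  unfolding mem_closure_iff_cylinder
proof (intro allI impI)
  fix \<rho> assume \<rho>: "\<rho> \<sqsubseteq> selection x"
  define h where "h = position x (length \<rho>)"
  have h: "legal_rounds Q h" "rounds_follow s t h" "x \<in> dom (current_problem Q h)"
    using position_correct[OF assms] by (auto simp: h_def)
  then obtain z where "z \<in> solutions (current_problem Q h) x"
    using solvable by blast
  then have z: "z \<in> solutions Q x" "\<forall>(p, q, \<rho>', \<sigma>) \<in> set h. \<rho>' \<sqsubseteq> z"
    using mem_solutions_current_problem[OF h(3)] by auto
  have "z i = selection x i" if i: "i < length \<rho>" for i
  proof -
    define g where "g = position x i"
    define p where "p = representative g x"
    have round: "position x (Suc i) ! i = (p, s g p, revealed g p, reply g p)"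
      by (simp add: g_def p_def Let_def nth_append)
    then have "h ! i = (p, s g p, revealed g p, reply g p)"
      using nth_position[OF i] by (simp add: h_def)
    then have "(p, s g p, revealed g p, reply g p) \<in> set h"
      using i by (metis h_def length_position nth_mem)
    then have "revealed g p \<sqsubseteq> z"
      using z(2) by blast
    (* Round i reveals i + 1 digits, just enough to include the digit at index i. *)
    then have "z i = s g p i"
      unfolding revealed_def initial_segment_map_iff by (simp add: g_def)
    then show ?thesis
      using round by (simp add: selection_def del: position.simps)
  qed
  then have "\<rho> \<sqsubseteq> z"
    using \<rho> by (simp add: initial_segment_def)
  with z(1) show "cylinder \<rho> \<inter> solutions Q x \<noteq> {}"
    by auto
qed

end

lemma wins_iff_selection:
  assumes closed: "\<And>p. p \<in> dom Q \<Longrightarrow> closed (solutions Q p)"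
  shows "player2_has_winning_strategy Q \<longleftrightarrow> (\<exists>f. continuous_selection Q f)"
proof
  assume "player2_has_winning_strategy Q"
  then obtain s t where "winning_strategy Q s t"
    unfolding player2_has_winning_strategy_iff winning_strategy_def by blast
  then interpret winning_strategy Q s t .
  have "continuous_selection Q selection"
    using continuous_on_selection selection_in_closure closed
    by (simp add: continuous_selection_def)
  then show "\<exists>f. continuous_selection Q f"
    by blast
qed (blast intro: selection_imp_wins)

theorem theorem6p1p2:
  fixes P :: problem
  shows "player2_has_winning_strategy (closure_problem P) \<longleftrightarrow>
    \<not> diagonalization_opportunities_continuous P"
proof -
  have "player2_has_winning_strategy (closure_problem P) \<longleftrightarrow>
      (\<exists>f. continuous_selection (closure_problem P) f)"
    by (rule wins_iff_selection) (simp add: solutions_closure_problem)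
  then show ?thesis
    by (simp add: no_opportunity_iff_selection)
qed

end
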